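(* Let $d$ and $n$ be positive integers, and let $\delta \ge c_n(S^d)$, which is satisfied if $\delta \ge \pi-p_{n+1}(\mathbb{R}P^d)$. Then for any continuous map $f\colon S^d \to \mathbb{R}^n$ there is a set $X \subset S^d$ of diameter at most $\delta$ such that the convex hulls of $f(X)$ and $f(-X)$ intersect. Moreover, the preimages of the intersection point have the same coefficients with respect to $X$ and $-X$, that is, $\int_{S^d} f(x) \, d\mu(x) = \int_{S^d} f(-x) \, d\mu(x)$ for some $\mu \in S^d_\delta$ with support contained in $X$.
   Context: $S^d\subset\mathbb{R}^{d+1}$ is the unit sphere with the geodesic (angular) metric $d(x,y)=\arccos\langle x,y\rangle$; diameters are in this metric, and $-X=\{-x:x\in X\}$. For a compact metric space $Y$ with a free $\mathbb{Z}/2$-action $y\mapsto -y$, the $\mathbb{Z}/2$-Carath\'eodory number $c_n(Y)$ is the infimum over all $t\in[0,\infty)$ such that for every continuous odd map $f\colon Y\to\mathbb{R}^n$ (i.e. $f(-y)=-f(y)$) there is a set $A\subset Y$ with $\mathrm{diam}(A)\le t$ and $0\in\mathrm{conv}(f(A))$. $S^d_\delta$ is the set of probability measures on $S^d$ whose support is finite and has diameter at most $\delta$. $\mathbb{R}P^d$ carries the metric in which the distance between two points is the angle in $[0,\pi/2]$ between the corresponding lines in $\mathbb{R}^{d+1}$. For a compact metric space $(Y,d)$ and $m\ge 1$, $p_m(Y)=\sup\{\varepsilon>0 : \text{there are } y_1,\dots,y_m\in Y \text{ with } d(y_i,y_j)\ge\varepsilon \text{ for all } i\ne j\}$. *)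

theory Defs
  imports "HOL-Probability.Probability"
begin

section \<open>Invariants of compact metric spaces\<close>

text \<open>Meaningful for bounded \<open>A\<close> only; every subset of a compact metric space is bounded.\<close>

definition mdiameter :: "'a metric \<Rightarrow> 'a set \<Rightarrow> real" where
  "mdiameter m A = (if A = {} then 0 else SUP (x, y)\<in>A \<times> A. mdist m x y)"

text \<open>The number \<open>c\<^sub>n(Y)\<close> for the compact metric space \<open>Y = m\<close> with free involution \<open>\<sigma>\<close>. The
  dimension \<open>n\<close> is the cardinality of the index type \<open>'n\<close>, passed as a type token.\<close>

definition z2_caratheodory :: "'n::finite itself \<Rightarrow> 'a metric \<Rightarrow> ('a \<Rightarrow> 'a) \<Rightarrow> real" where
  "z2_caratheodory _ m \<sigma> = Inf {t. 0 \<le> t \<and>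
     (\<forall>f :: 'a \<Rightarrow> real^'n.
        continuous_map (mtopology_of m) euclidean f \<and> (\<forall>y\<in>mspace m. f (\<sigma> y) = - f y) \<longrightarrow>
        (\<exists>A. A \<subseteq> mspace m \<and> mdiameter m A \<le> t \<and> 0 \<in> convex hull (f ` A)))}"

text \<open>The number \<open>p\<^sub>m(Y)\<close> for \<open>Y = M\<close>; the set is bounded above when \<open>m \<ge> 2\<close> and \<open>M\<close> is compact.\<close>

definition packing_number :: "nat \<Rightarrow> 'a metric \<Rightarrow> real" where
  "packing_number m M = Sup {\<epsilon>. 0 < \<epsilon> \<and>
     (\<exists>y :: nat \<Rightarrow> 'a. y ` {1..m} \<subseteq> mspace M \<and>
        (\<forall>i\<in>{1..m}. \<forall>j\<in>{1..m}. i \<noteq> j \<longrightarrow> \<epsilon> \<le> mdist M (y i) (y j)))}"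

text \<open>Probability measures with finite support of diameter at most \<open>\<delta>\<close>; a finitely supported
  probability measure is the same thing as a probability mass function with finite support. For
  the sphere this is the set written \<open>S\<^sup>d\<^sub>\<delta>\<close>.\<close>

definition thickening :: "'a metric \<Rightarrow> real \<Rightarrow> 'a pmf set" where
  "thickening m \<delta> =
     {\<mu>. finite (set_pmf \<mu>) \<and> set_pmf \<mu> \<subseteq> mspace m \<and> mdiameter m (set_pmf \<mu>) \<le> \<delta>}"


section \<open>The sphere with its geodesic metric\<close>

text \<open>The locale \<open>Metric_space\<close> asks for nonnegativity and symmetry off the carrier too, hence the
  value 0 there.\<close>

definition sphere_dist :: "'a::euclidean_space \<Rightarrow> 'a \<Rightarrow> real" where
  "sphere_dist x y = (if x \<in> sphere 0 1 \<and> y \<in> sphere 0 1 then arccos (x \<bullet> y) else 0)"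

definition sphere_metric :: "'a::euclidean_space metric" where
  "sphere_metric = metric (sphere 0 1, sphere_dist)"

lemma unit_inner_bounds:
  fixes x y :: "'a::real_inner"
  assumes "norm x = 1" "norm y = 1"
  shows "-1 \<le> x \<bullet> y" "x \<bullet> y \<le> 1" "\<bar>x \<bullet> y\<bar> \<le> 1"
  using Cauchy_Schwarz_ineq2[of x y] assms by auto

lemma unit_inner_eq_1:
  fixes x y :: "'a::real_inner"
  assumes "norm x = 1" "norm y = 1"
  shows "x \<bullet> y = 1 \<longleftrightarrow> x = y"
proof
  assume "x \<bullet> y = 1"
  then have "(x - y) \<bullet> (x - y) = 0"
    using assms by (simp add: inner_diff inner_commute norm_eq_1)
  then show "x = y" by (simp only: inner_eq_zero_iff right_minus_eq)
qed (use assms in \<open>simp add: norm_eq_1\<close>)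

lemma arccos_inner_triangle:
  fixes x y z :: "'a::real_inner"
  assumes "norm x = 1" "norm y = 1" "norm z = 1"
  shows "arccos (x \<bullet> z) \<le> arccos (x \<bullet> y) + arccos (y \<bullet> z)"
proof (cases "arccos (x \<bullet> y) + arccos (y \<bullet> z) \<le> pi")
  case False
  then show ?thesis
    using arccos_ubound[OF unit_inner_bounds(1,2)[OF assms(1,3)]] by linarith
next
  case True
  define a b where "a = arccos (x \<bullet> y)" and "b = arccos (y \<bullet> z)"
  have yy: "y \<bullet> y = 1" "x \<bullet> x = 1" "z \<bullet> z = 1"
    using assms by (simp_all add: dot_square_norm)
  have ab: "cos a = x \<bullet> y" "cos b = y \<bullet> z" "0 \<le> a" "0 \<le> b"
    "sin a = sqrt (1 - (x \<bullet> y)\<^sup>2)" "sin b = sqrt (1 - (y \<bullet> z)\<^sup>2)"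
    unfolding a_def b_def using unit_inner_bounds[OF assms(1,2)] unit_inner_bounds[OF assms(2,3)]
    by (simp_all add: arccos_lbound sin_arccos_abs)
  define u v where "u = x - (x \<bullet> y) *\<^sub>R y" and "v = z - (y \<bullet> z) *\<^sub>R y"
  have uv: "u \<bullet> v = x \<bullet> z - (x \<bullet> y) * (y \<bullet> z)"
    unfolding u_def v_def using yy by (simp add: inner_diff inner_commute algebra_simps)
  have "norm u = sin a" "norm v = sin b"
    unfolding norm_eq_sqrt_inner ab u_def v_def using yy
    by (simp_all add: inner_diff inner_commute algebra_simps power2_eq_square)
  then have "- (sin a * sin b) \<le> u \<bullet> v"
    using Cauchy_Schwarz_ineq2[of u v] by (simp add: abs_le_iff)
  then have "cos (a + b) \<le> x \<bullet> z"
    using uv ab by (simp add: cos_add)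
  then have "arccos (x \<bullet> z) \<le> arccos (cos (a + b))"
    using unit_inner_bounds[OF assms(1,3)] by (intro arccos_le_arccos) auto
  also have "\<dots> = a + b"
    using True ab by (intro arccos_cos) (auto simp: a_def b_def)
  finally show ?thesis by (simp add: a_def b_def)
qed

interpretation sphere_ms: Metric_space "sphere 0 1 :: 'a::euclidean_space set" sphere_dist
proof
  fix x y z :: 'a
  show "0 \<le> sphere_dist x y"
    by (auto simp: sphere_dist_def intro!: arccos_lbound unit_inner_bounds)
  show "sphere_dist x y = sphere_dist y x"
    by (simp add: sphere_dist_def inner_commute)
  assume xy: "x \<in> sphere 0 1" "y \<in> sphere 0 1"
  show "sphere_dist x y = 0 \<longleftrightarrow> x = y"
    using xy unit_inner_bounds[of x y]
    by (simp add: sphere_dist_def arccos_eq_0_iff unit_inner_eq_1)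
  assume "z \<in> sphere 0 1"
  then show "sphere_dist x z \<le> sphere_dist x y + sphere_dist y z"
    using xy by (simp add: sphere_dist_def arccos_inner_triangle)
qed

lemma mspace_sphere_metric [simp]: "mspace sphere_metric = sphere 0 1"
  by (simp add: sphere_metric_def)

lemma mdist_sphere_metric: "mdist sphere_metric = sphere_dist"
  by (simp add: sphere_metric_def)

lemma dist_le_arccos_inner:
  fixes x y :: "'a::real_inner"
  assumes "norm x = 1" "norm y = 1"
  shows "dist x y \<le> arccos (x \<bullet> y)"
proof -
  define t where "t = arccos (x \<bullet> y)"
  have t: "0 \<le> t" "cos t = x \<bullet> y"
    using unit_inner_bounds[OF assms] by (auto simp: t_def arccos_lbound)
  have "(dist x y)\<^sup>2 = 2 - 2 * cos t"
    using assms unfolding dist_norm power2_norm_eq_inner t norm_eq_1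
    by (simp only: inner_diff_left inner_diff_right) (simp add: inner_commute)
  also have "\<dots> = 4 * (sin (t / 2))\<^sup>2"
    using cos_double_sin[of "t / 2"] by simp
  also have "\<dots> \<le> 4 * (t / 2)\<^sup>2"
    using abs_sin_x_le_abs_x[of "t / 2"] by (simp only: abs_le_square_iff)
  also have "\<dots> = t\<^sup>2"
    by (simp add: power2_eq_square)
  finally show ?thesis
    using t by (simp add: t_def power2_le_iff_abs_le)
qed

text \<open>The geodesic metric induces the usual topology of the sphere.\<close>

lemma mtopology_of_sphere_metric:
  "mtopology_of sphere_metric = top_of_set (sphere 0 1 :: 'a::euclidean_space set)"
proof (rule topology_eq[THEN iffD2], intro allI)
  fix U :: "'a set"
  let ?S = "sphere 0 1 :: 'a set"
  have "(\<exists>r>0. sphere_ms.mball x r \<subseteq> U) \<longleftrightarrow> (\<exists>e>0. \<forall>x'\<in>?S. dist x' x < e \<longrightarrow> x' \<in> U)"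
    if x: "x \<in> ?S" for x
  proof
    assume "\<exists>r>0. sphere_ms.mball x r \<subseteq> U"
    then obtain r where r: "r > 0" "sphere_ms.mball x r \<subseteq> U" by blast
    have "continuous_on ?S (\<lambda>y. arccos (x \<bullet> y))"
      using x by (intro continuous_intros) (auto intro!: unit_inner_bounds)
    then obtain e where "e > 0"
      and e: "\<And>x'. x' \<in> ?S \<Longrightarrow> dist x' x < e \<Longrightarrow> dist (arccos (x \<bullet> x')) (arccos (x \<bullet> x)) < r"
      using x r(1) unfolding continuous_on_iff by blast
    have "x' \<in> U" if "x' \<in> ?S" "dist x' x < e" for x'
      using e[OF that] that x r(2)
      by (auto simp: sphere_dist_def dot_square_norm dist_real_def subset_iff)
    with \<open>e > 0\<close> show "\<exists>e>0. \<forall>x'\<in>?S. dist x' x < e \<longrightarrow> x' \<in> U" by blast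
  next
    assume "\<exists>e>0. \<forall>x'\<in>?S. dist x' x < e \<longrightarrow> x' \<in> U"
    then obtain e where e: "e > 0" "\<forall>x'\<in>?S. dist x' x < e \<longrightarrow> x' \<in> U" by blast
    have "sphere_ms.mball x e \<subseteq> U"
    proof
      fix y assume "y \<in> sphere_ms.mball x e"
      then have "y \<in> ?S" "arccos (x \<bullet> y) < e"
        using x by (auto simp: sphere_dist_def)
      moreover have "dist x y \<le> arccos (x \<bullet> y)"
        using x \<open>y \<in> ?S\<close> by (intro dist_le_arccos_inner) auto
      ultimately show "y \<in> U"
        using e(2) by (auto simp: dist_commute)
    qed
    with e(1) show "\<exists>r>0. sphere_ms.mball x r \<subseteq> U" by blast
  qed
  then show "openin (mtopology_of sphere_metric) U = openin (top_of_set ?S) U"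
    unfolding mtopology_of_def mspace_sphere_metric mdist_sphere_metric
      sphere_ms.openin_mtopology openin_euclidean_subtopology_iff
    by (auto simp: subset_iff)
qed


section \<open>Real projective space\<close>

definition proj_space :: "'a::euclidean_space set set" where
  "proj_space = {L. subspace L \<and> dim L = 1}"

text \<open>The angle in \<open>[0, \<pi>/2]\<close> between two lines is the smallest angle between unit vectors on them;
  see \<open>line_angle_span\<close>.\<close>

definition line_angle :: "'a::euclidean_space set \<Rightarrow> 'a set \<Rightarrow> real" where
  "line_angle L M =
     (if L \<in> proj_space \<and> M \<in> proj_space
      then INF (u, v)\<in>(L \<inter> sphere 0 1) \<times> (M \<inter> sphere 0 1). arccos (u \<bullet> v) else 0)"

definition proj_metric :: "'a::euclidean_space set metric" where
  "proj_metric = metric (proj_space, line_angle)"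

lemma proj_space_spanE:
  assumes "L \<in> proj_space"
  obtains u where "norm u = 1" "L = span {u}"
proof -
  have L: "subspace L" "dim L = 1"
    using assms by (auto simp: proj_space_def)
  obtain B where B: "B \<subseteq> L" "independent B" "L \<subseteq> span B" "card B = dim L"
    using basis_exists by blast
  then obtain b where b: "B = {b}"
    using L(2) card_1_singletonE by metis
  have "L = span {b}"
    using B L(1) b span_minimal by blast
  moreover have "b \<noteq> 0"
    using B(2) b dependent_zero by blast
  moreover have "span {b /\<^sub>R norm b} = span {b}"
    using \<open>b \<noteq> 0\<close> by (intro span_image_scale[of "{b}" "\<lambda>_. inverse (norm b)", simplified])
  ultimately show thesis
    by (intro that[of "b /\<^sub>R norm b"]) auto
qed

lemma span_unit_in_proj_space [simp]: "norm u = 1 \<Longrightarrow> span {u} \<in> proj_space"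
  by (auto simp: proj_space_def)

lemma span_unit_Int_sphere:
  fixes u :: "'a::euclidean_space"
  assumes "norm u = 1"
  shows "span {u} \<inter> sphere 0 1 = {u, - u}"
proof
  show "span {u} \<inter> sphere 0 1 \<subseteq> {u, - u}"
    using assms by (auto simp: span_singleton abs_if split: if_splits)
  show "{u, - u} \<subseteq> span {u} \<inter> sphere 0 1"
    using assms by (simp add: span_base span_neg)
qed

lemma line_angle_span:
  fixes u v :: "'a::euclidean_space"
  assumes "norm u = 1" "norm v = 1"
  shows "line_angle (span {u}) (span {v}) = arccos \<bar>u \<bullet> v\<bar>"
proof -
  note b = unit_inner_bounds[OF assms]
  have "line_angle (span {u}) (span {v}) =
      Min {arccos (u \<bullet> v), arccos (- (u \<bullet> v))}"
    using assms
    by (simp add: line_angle_def span_unit_Int_sphere insert_Times_insert cInf_eq_Min)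
  also have "\<dots> = arccos \<bar>u \<bullet> v\<bar>"
    using b arccos_le_mono[of "u \<bullet> v" "- (u \<bullet> v)"] by (auto simp: abs_if min_def)
  finally show ?thesis .
qed

lemma span_unit_eq:
  fixes u v :: "'a::euclidean_space"
  assumes "norm u = 1" "norm v = 1" "\<bar>u \<bullet> v\<bar> = 1"
  shows "span {u} = span {v}"
proof -
  have "u = v \<or> u = - v"
    using assms unit_inner_eq_1[of u v] unit_inner_eq_1[of u "- v"] by (auto simp: abs_if split: if_splits)
  then show ?thesis
  proof
    assume "u = - v"
    then have "u \<in> span {v}" "v \<in> span {u}"
      by (auto simp: span_singleton intro: range_eqI[of _ _ "-1"])
    then show ?thesis
      by (simp add: span_eq)
  qed simp
qed

interpretation proj_ms: Metric_space "proj_space :: 'a::euclidean_space set set" line_angle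
proof
  fix L M N :: "'a set"
  show "0 \<le> line_angle L M"
  proof (cases "L \<in> proj_space \<and> M \<in> proj_space")
    case True
    then obtain u v where "norm u = 1" "L = span {u}" "norm v = 1" "M = span {v}"
      by (metis proj_space_spanE)
    then show ?thesis
      using unit_inner_bounds[of u v] by (auto simp: line_angle_span intro!: arccos_lbound)
  qed (auto simp: line_angle_def)
  show "line_angle L M = line_angle M L"
  proof (cases "L \<in> proj_space \<and> M \<in> proj_space")
    case True
    then obtain u v where "norm u = 1" "L = span {u}" "norm v = 1" "M = span {v}"
      by (metis proj_space_spanE)
    then show ?thesis
      by (simp add: line_angle_span inner_commute)
  qed (auto simp: line_angle_def)
  assume "L \<in> proj_space" "M \<in> proj_space"
  then obtain u v where u: "norm u = 1" "L = span {u}" and v: "norm v = 1" "M = span {v}"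
    by (metis proj_space_spanE)
  show "line_angle L M = 0 \<longleftrightarrow> L = M"
  proof
    assume "line_angle L M = 0"
    then have "\<bar>u \<bullet> v\<bar> = 1"
      using u v unit_inner_bounds[of u v] arccos_eq_0_iff[of "\<bar>u \<bullet> v\<bar>"]
      by (simp add: line_angle_span)
    then show "L = M"
      using u v span_unit_eq by blast
  next
    assume "L = M"
    then have "line_angle L M = line_angle (span {u}) (span {u})"
      using u by simp
    then show "line_angle L M = 0"
      using u(1) by (simp add: line_angle_span norm_eq_1)
  qed
  assume "N \<in> proj_space"
  then obtain w where w: "norm w = 1" "N = span {w}"
    by (metis proj_space_spanE)
  define u' where "u' = (if 0 \<le> u \<bullet> v then u else - u)"
  define w' where "w' = (if 0 \<le> v \<bullet> w then w else - w)"
  have n: "norm u' = 1" "norm w' = 1"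
    using u w by (auto simp: u'_def w'_def)
  have "arccos \<bar>u \<bullet> w\<bar> \<le> arccos (u' \<bullet> w')"
    using unit_inner_bounds[OF u(1) w(1)]
    by (intro arccos_le_arccos) (auto simp: u'_def w'_def)
  also have "\<dots> \<le> arccos (u' \<bullet> v) + arccos (v \<bullet> w')"
    using n v by (intro arccos_inner_triangle)
  also have "u' \<bullet> v = \<bar>u \<bullet> v\<bar>"
    by (simp add: u'_def)
  also have "v \<bullet> w' = \<bar>v \<bullet> w\<bar>"
    by (simp add: w'_def)
  finally show "line_angle L N \<le> line_angle L M + line_angle M N"
    using u v w by (simp add: line_angle_span)
qed

lemma mspace_proj_metric [simp]: "mspace proj_metric = proj_space"
  by (simp add: proj_metric_def)

lemma mdist_proj_metric: "mdist proj_metric = line_angle"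
  by (simp add: proj_metric_def)

end

theory Submission
  imports Defs
begin

text \<open>
  \<^bold>\<open>The bound on the Caratheodory number.\<close> Let \<open>\<epsilon>\<close> be a common lower bound for the angles between
  \<open>n + 1\<close> lines, and choose a unit vector \<open>u\<^sub>i\<close> on each of them. Whatever signs \<open>s\<^sub>i\<close> are chosen, the
  angle between \<open>s\<^sub>i u\<^sub>i\<close> and \<open>s\<^sub>j u\<^sub>j\<close> is either the angle of the two lines or its supplement. The
  former lies between \<open>\<epsilon>\<close> and \<open>\<pi> / 2\<close>, so neither exceeds \<open>\<pi> - \<epsilon>\<close>, and the points \<open>s\<^sub>i u\<^sub>i\<close> form a set of
  diameter at most \<open>\<pi> - \<epsilon>\<close>. If \<open>f\<close> is odd, the \<open>n + 1\<close> vectors \<open>f (u\<^sub>i)\<close>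
  of \<open>\<real>\<^sup>n\<close> satisfy a nontrivial linear relation, and moving the signs of its coefficients into the
  arguments of \<open>f\<close> turns it into a convex combination of the \<open>f (s\<^sub>i u\<^sub>i)\<close> that vanishes
  (\<open>zero_in_hull_sign_choice\<close>). Topologically this is the Borsuk-Ulam theorem for the map on the
  boundary of the cross-polytope that sends the vertices to the vectors \<open>\<plusminus>f (u\<^sub>i)\<close> and is affine on
  each face; as this map is the restriction of a linear one, linear algebra suffices. The bound \<open>c\<^sub>n(S\<^sup>d) \<le> \<pi> - p\<^sub>n\<^sub>+\<^sub>1(\<real>P\<^sup>d)\<close> follows by taking the supremum over \<open>\<epsilon>\<close>.

  \<^bold>\<open>The coincidence.\<close> For continuous \<open>f\<close> the map \<open>g x = f x - f (- x)\<close> is odd and continuous. If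
  0 lies in the convex hull of \<open>g (X)\<close>, then the weights of a convex combination that shows this
  form a probability measure \<open>\<mu>\<close> on \<open>X\<close> with \<open>\<integral> f x d\<mu> = \<integral> f (- x) d\<mu>\<close>, and this common value is a
  point of both convex hulls. It remains to find \<open>X\<close> with diameter at most \<open>c\<^sub>n(S\<^sup>d)\<close>, not only
  arbitrarily close to it. By Caratheodory's theorem \<open>n + 1\<close> points with weights are enough, such
  configurations form a compact space, and so some set has the least diameter
  (\<open>exists_hull_set_of_least_diameter\<close>).
\<close>

section \<open>The diameter of subsets of the sphere\<close>

lemma arccos_le_mdiameter:
  assumes "A \<subseteq> sphere 0 1" "x \<in> A" "y \<in> A"
  shows "arccos (x \<bullet> y) \<le> mdiameter sphere_metric A"
proof -
  have "sphere_dist u v \<le> pi" if "u \<in> A" "v \<in> A" for u v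
    using that assms(1) unit_inner_bounds[of u v]
    by (auto simp: sphere_dist_def subset_iff intro!: arccos_ubound)
  then have "bdd_above ((\<lambda>(x, y). sphere_dist x y) ` (A \<times> A))"
    by (intro bdd_aboveI[of _ pi]) auto
  then have "(case (x, y) of (x, y) \<Rightarrow> sphere_dist x y) \<le> (SUP (x, y)\<in>A \<times> A. sphere_dist x y)"
    using assms by (intro cSUP_upper) auto
  moreover have "A \<noteq> {}"
    using assms by blast
  ultimately have "sphere_dist x y \<le> mdiameter sphere_metric A"
    by (simp add: mdiameter_def mdist_sphere_metric)
  then show ?thesis
    using assms by (auto simp: sphere_dist_def subset_iff)
qed

lemma mdiameter_sphere_leI:
  assumes "A \<subseteq> sphere 0 1" "0 \<le> t" "\<And>x y. x \<in> A \<Longrightarrow> y \<in> A \<Longrightarrow> arccos (x \<bullet> y) \<le> t"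
  shows "mdiameter sphere_metric A \<le> t"
proof (cases "A = {}")
  case False
  have "sphere_dist x y \<le> t" if "x \<in> A" "y \<in> A" for x y
    using that assms by (simp add: sphere_dist_def)
  then have "(SUP (x, y)\<in>A \<times> A. sphere_dist x y) \<le> t"
    using False by (intro cSUP_least) auto
  with False show ?thesis
    by (simp add: mdiameter_def mdist_sphere_metric)
qed (use assms in \<open>simp add: mdiameter_def\<close>)

lemma mdiameter_sphere_nonneg:
  assumes "A \<subseteq> sphere 0 1"
  shows "0 \<le> mdiameter sphere_metric A"
proof (cases "A = {}")
  case False
  then obtain x where "x \<in> A" by blast
  with assms have "0 \<le> arccos (x \<bullet> x)"
    by (intro arccos_lbound unit_inner_bounds) auto
  with \<open>x \<in> A\<close> show ?thesis
    using arccos_le_mdiameter[OF assms, of x x] by linarith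
qed (simp add: mdiameter_def)

lemma mdiameter_sphere_mono:
  assumes "B \<subseteq> sphere 0 1" "A \<subseteq> B"
  shows "mdiameter sphere_metric A \<le> mdiameter sphere_metric B"
  using assms by (intro mdiameter_sphere_leI mdiameter_sphere_nonneg arccos_le_mdiameter) auto

section \<open>Sets of least diameter\<close>

text \<open>Caratheodory's theorem with a fixed index type: the space of all families \<open>(w, x)\<close> does not
  depend on \<open>y\<close> or \<open>B\<close>, which is what a compactness argument needs. Unused indices carry the
  weight 0 and an arbitrary point of \<open>B\<close>, so that they do not enlarge the set of points.\<close>

lemma caratheodory_family:
  fixes f :: "'a \<Rightarrow> real^'n"
  assumes "y \<in> convex hull (f ` B)"
  obtains w :: "'n option \<Rightarrow> real" and x :: "'n option \<Rightarrow> 'a"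
  where "\<And>i. 0 \<le> w i" "\<And>i. x i \<in> B" "(\<Sum>i\<in>UNIV. w i) = 1" "(\<Sum>i\<in>UNIV. w i *\<^sub>R f (x i)) = y"
proof -
  obtain S u where S: "finite S" "S \<subseteq> f ` B" "card S \<le> CARD('n) + 1"
    and u: "\<forall>s\<in>S. 0 \<le> u s" "sum u S = 1" "(\<Sum>s\<in>S. u s *\<^sub>R s) = y"
    using assms unfolding convex_hull_caratheodory by auto
  obtain h :: "_ \<Rightarrow> 'n option" where h: "inj_on h S"
    using card_le_inj[of S "UNIV :: 'n option set"] S by (auto simp: card_UNIV_option)
  define p where "p = inv_into B f"
  have p: "p s \<in> B" "f (p s) = s" if "s \<in> S" for s
    using S(2) that by (auto simp: p_def inv_into_into f_inv_into_f)
  obtain b where "b \<in> B"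
    using u(2) S(2) by fastforce
  define w where "w i = (if i \<in> h ` S then u (inv_into S h i) else 0)" for i
  define x where "x i = (if i \<in> h ` S then p (inv_into S h i) else b)" for i
  have "(\<Sum>i\<in>UNIV. w i) = (\<Sum>i\<in>h ` S. w i)"
    by (intro sum.mono_neutral_right) (auto simp: w_def)
  also have "\<dots> = sum u S"
    using h by (simp add: sum.reindex w_def)
  finally have 1: "(\<Sum>i\<in>UNIV. w i) = 1"
    using u by simp
  have "(\<Sum>i\<in>UNIV. w i *\<^sub>R f (x i)) = (\<Sum>i\<in>h ` S. w i *\<^sub>R f (x i))"
    by (intro sum.mono_neutral_right) (auto simp: w_def)
  also have "\<dots> = (\<Sum>s\<in>S. u s *\<^sub>R s)"
    using h p by (simp add: sum.reindex w_def x_def)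
  finally have 2: "(\<Sum>i\<in>UNIV. w i *\<^sub>R f (x i)) = y"
    using u by simp
  show thesis
    by (rule that[of w x]) (use u p h \<open>b \<in> B\<close> 1 2 in \<open>auto simp: w_def x_def\<close>)
qed

lemma compact_vec_box:
  fixes B :: "'a::euclidean_space set"
  assumes "compact B"
  shows "compact {z :: 'a^'m. \<forall>i. z $ i \<in> B}"
proof -
  have "closed {z :: 'a^'m. \<forall>i. z $ i \<in> B}"
    using closed_vimage_vec_nth[OF compact_imp_closed[OF assms]]
    by (intro closed_Collect_all) (simp add: vimage_def)
  moreover obtain r where r: "\<And>b. b \<in> B \<Longrightarrow> norm b \<le> r"
    using assms compact_imp_bounded bounded_iff by metis
  have "bounded {z :: 'a^'m. \<forall>i. z $ i \<in> B}"
  proof (rule boundedI)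
    fix z :: "'a^'m" assume "z \<in> {z. \<forall>i. z $ i \<in> B}"
    then have "(\<Sum>i\<in>UNIV. norm (z $ i)) \<le> (\<Sum>i\<in>(UNIV :: 'm set). r)"
      by (intro sum_mono r) auto
    moreover have "norm z \<le> (\<Sum>i\<in>UNIV. norm (z $ i))"
      unfolding norm_vec_def by (rule L2_set_le_sum) simp
    ultimately show "norm z \<le> (\<Sum>i\<in>(UNIV :: 'm set). r)"
      by linarith
  qed
  ultimately show ?thesis
    by (simp add: compact_eq_bounded_closed)
qed

lemma continuous_on_Max:
  fixes g :: "'i \<Rightarrow> 'a::topological_space \<Rightarrow> 'b::linorder_topology"
  assumes "finite I" "I \<noteq> {}" "\<And>i. i \<in> I \<Longrightarrow> continuous_on S (g i)"
  shows "continuous_on S (\<lambda>x. Max ((\<lambda>i. g i x) ` I))"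
  using assms by (induction I rule: finite_ne_induct) (auto intro!: continuous_on_max)

text \<open>A set whose image has \<open>y\<close> in its convex hull may be replaced by the \<open>n + 1\<close> points of a
  Caratheodory family. The weighted families that represent \<open>y\<close> form a compact set \<open>K\<close>, on which
  the largest angle \<open>D\<close> between two points is continuous, so \<open>D\<close> has a minimum.\<close>

lemma exists_hull_set_of_least_diameter:
  fixes f :: "'a::euclidean_space \<Rightarrow> real^'n"
  assumes cont: "continuous_on (sphere 0 1) f"
    and ex: "A\<^sub>0 \<subseteq> sphere 0 1" "y \<in> convex hull (f ` A\<^sub>0)"
  obtains A where "A \<subseteq> sphere 0 1" "y \<in> convex hull (f ` A)"
    "\<And>B. B \<subseteq> sphere 0 1 \<Longrightarrow> y \<in> convex hull (f ` B) \<Longrightarrow>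
       mdiameter sphere_metric A \<le> mdiameter sphere_metric B"
proof -
  define C where "C = {z :: (real \<times> 'a)^('n option). \<forall>i. z $ i \<in> {0..1} \<times> sphere 0 1}"
  define F where "F z = (\<Sum>i\<in>UNIV. fst (z $ i), \<Sum>i\<in>UNIV. fst (z $ i) *\<^sub>R f (snd (z $ i)))"
    for z :: "(real \<times> 'a)^('n option)"
  define K where "K = {z \<in> C. F z = (1, y)}"
  define D where "D z = Max ((\<lambda>(i, j). arccos (snd (z $ i) \<bullet> snd (z $ j))) ` UNIV)"
    for z :: "(real \<times> 'a)^('n option)"
  have "compact C"
    unfolding C_def by (intro compact_vec_box compact_Times) auto
  have "continuous_on C (\<lambda>z. f (snd (z $ i)))" for i
    by (rule continuous_on_compose2[OF cont])
      (auto simp: C_def mem_Times_iff intro!: continuous_intros)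
  then have "continuous_on C F"
    unfolding F_def by (intro continuous_intros)
  then have "compact K"
    using continuous_closed_preimage_constant[of C F "(1, y)"] \<open>compact C\<close>
      compact_Int_closed[OF \<open>compact C\<close>, of K]
    by (simp add: K_def compact_imp_closed Int_def)
  have CD: "continuous_on C D"
    unfolding D_def
    by (intro continuous_on_Max)
      (auto simp: C_def mem_Times_iff split_beta intro!: continuous_intros unit_inner_bounds)
  \<comment> \<open>Every competitor \<open>B\<close> contains the points of some element of \<open>K\<close>.\<close>
  have below: "\<exists>z\<in>K. D z \<le> mdiameter sphere_metric B"
    if B: "B \<subseteq> sphere 0 1" "y \<in> convex hull (f ` B)" for B
  proof -
    obtain w :: "'n option \<Rightarrow> real" and x :: "'n option \<Rightarrow> 'a"
      where w: "\<And>i. 0 \<le> w i" "(\<Sum>i\<in>UNIV. w i) = 1" and x: "\<And>i. x i \<in> B"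
        and y: "(\<Sum>i\<in>UNIV. w i *\<^sub>R f (x i)) = y"
      using caratheodory_family[OF B(2)] by metis
    have "w i \<le> 1" for i
      using member_le_sum[of i UNIV w] w by simp
    then have "(\<chi> i. (w i, x i)) \<in> K"
      using w x y B(1) by (auto simp: K_def C_def F_def subset_iff)
    moreover have "D (\<chi> i. (w i, x i)) \<le> mdiameter sphere_metric B"
      unfolding D_def using B(1) x by (subst Max_le_iff) (auto intro: arccos_le_mdiameter)
    ultimately show ?thesis by blast
  qed
  have "K \<noteq> {}"
    using below[OF ex] by blast
  then obtain z where z: "z \<in> K" and least: "\<And>z'. z' \<in> K \<Longrightarrow> D z \<le> D z'"
    using continuous_attains_inf[OF \<open>compact K\<close>, of D] continuous_on_subset[OF CD, of K]
    by (auto simp: K_def)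
  define A where "A = range (\<lambda>i. snd (z $ i))"
  have zi: "0 \<le> fst (z $ i)" "snd (z $ i) \<in> sphere 0 1" for i
    using z by (auto simp: K_def C_def mem_Times_iff)
  then have A: "A \<subseteq> sphere 0 1"
    by (auto simp: A_def)
  have "(\<Sum>i\<in>UNIV. fst (z $ i) *\<^sub>R f (snd (z $ i))) \<in> convex hull (f ` A)"
    using z zi by (intro convex_sum) (auto simp: K_def F_def A_def intro!: hull_inc)
  then have "y \<in> convex hull (f ` A)"
    using z by (simp add: K_def F_def)
  moreover have "mdiameter sphere_metric A \<le> mdiameter sphere_metric B"
    if B: "B \<subseteq> sphere 0 1" "y \<in> convex hull (f ` B)" for B
  proof (rule mdiameter_sphere_leI[OF A mdiameter_sphere_nonneg[OF B(1)]])
    fix a a' assume "a \<in> A" "a' \<in> A"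
    then have "arccos (a \<bullet> a') \<le> D z"
      unfolding D_def A_def by (intro Max_ge) (auto intro: range_eqI)
    also obtain z' where "z' \<in> K" "D z' \<le> mdiameter sphere_metric B"
      using below[OF B] by blast
    then have "D z \<le> mdiameter sphere_metric B"
      using least by force
    finally show "arccos (a \<bullet> a') \<le> mdiameter sphere_metric B" .
  qed
  ultimately show thesis
    using that A by blast
qed

section \<open>The Caratheodory number of the sphere\<close>

lemma zero_in_hull_antipodal_pair:
  fixes f :: "'a::real_vector \<Rightarrow> 'b::real_vector"
  assumes "f (- x) = - f x"
  shows "0 \<in> convex hull (f ` {x, - x})"
proof -
  have "0 = (1/2) *\<^sub>R f x + (1/2) *\<^sub>R f (- x)"
    using assms by simp
  then show ?thesis
    unfolding image_insert image_empty convex_hull_2 by force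
qed

text \<open>The infimum in the definition ranges over bounds that hold for all odd maps at once. The
  least diameter for the single map \<open>f\<close> is at most each of these bounds, hence at most their infimum.\<close>

lemma z2_caratheodory_sphere_attained:
  fixes f :: "'a::euclidean_space \<Rightarrow> real^'n"
  assumes cont: "continuous_on (sphere 0 1) f" and odd: "\<And>x. x \<in> sphere 0 1 \<Longrightarrow> f (- x) = - f x"
  obtains A where "A \<subseteq> sphere 0 1" "0 \<in> convex hull (f ` A)"
    "mdiameter sphere_metric A \<le> z2_caratheodory TYPE('n) (sphere_metric :: 'a metric) uminus"
proof -
  obtain e :: 'a where e: "e \<in> sphere 0 1"
    using vector_choose_size[of 1] by auto
  have pair: "{e, - e} \<subseteq> sphere 0 1"
    using e by auto
  obtain A where A: "A \<subseteq> sphere 0 1" "0 \<in> convex hull (f ` A)"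
    and least: "\<And>B. B \<subseteq> sphere 0 1 \<Longrightarrow> 0 \<in> convex hull (f ` B) \<Longrightarrow>
       mdiameter sphere_metric A \<le> mdiameter sphere_metric B"
    using exists_hull_set_of_least_diameter[OF cont pair zero_in_hull_antipodal_pair[OF odd[OF e]]]
    by metis
  \<comment> \<open>An antipodal pair serves every odd map, so the infimum is not that of the empty set.\<close>
  have "mdiameter sphere_metric {e, - e} \<le> pi"
    using pair by (intro mdiameter_sphere_leI arccos_ubound unit_inner_bounds) auto
  then have pi: "\<exists>A. A \<subseteq> sphere 0 1 \<and> mdiameter sphere_metric A \<le> pi \<and> 0 \<in> convex hull (g ` A)"
    if "\<forall>x\<in>sphere 0 1. g (- x) = - g x" for g :: "'a \<Rightarrow> real^'n"
    using that pair e zero_in_hull_antipodal_pair[of g e] by blast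
  have "mdiameter sphere_metric A \<le> z2_caratheodory TYPE('n) (sphere_metric :: 'a metric) uminus"
    unfolding z2_caratheodory_def
  proof (rule cInf_greatest)
    show "{t. 0 \<le> t \<and> (\<forall>f :: 'a \<Rightarrow> real^'n.
        continuous_map (mtopology_of sphere_metric) euclidean f \<and>
        (\<forall>y\<in>mspace sphere_metric. f (- y) = - f y) \<longrightarrow>
        (\<exists>A. A \<subseteq> mspace sphere_metric \<and> mdiameter sphere_metric A \<le> t \<and>
           0 \<in> convex hull (f ` A)))} \<noteq> {}"
      using pi by (auto intro!: exI[of _ pi])
  next
    fix t assume "t \<in> {t. 0 \<le> t \<and> (\<forall>f :: 'a \<Rightarrow> real^'n.
        continuous_map (mtopology_of sphere_metric) euclidean f \<and>
        (\<forall>y\<in>mspace sphere_metric. f (- y) = - f y) \<longrightarrow>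
        (\<exists>A. A \<subseteq> mspace sphere_metric \<and> mdiameter sphere_metric A \<le> t \<and>
           0 \<in> convex hull (f ` A)))}"
    then obtain B where "B \<subseteq> sphere 0 1" "mdiameter sphere_metric B \<le> t"
      "0 \<in> convex hull (f ` B)"
      using cont odd by (auto simp: mtopology_of_sphere_metric)
    then show "mdiameter sphere_metric A \<le> t"
      using least[of B] by linarith
  qed
  with A show thesis
    by (rule that)
qed

lemma z2_caratheodory_sphere_le:
  assumes "0 \<le> t"
    and "\<And>f :: 'a::euclidean_space \<Rightarrow> real^'n.
      \<lbrakk>continuous_on (sphere 0 1) f; \<And>x. x \<in> sphere 0 1 \<Longrightarrow> f (- x) = - f x\<rbrakk> \<Longrightarrow>
      \<exists>A \<subseteq> sphere 0 1. mdiameter sphere_metric A \<le> t \<and> 0 \<in> convex hull (f ` A)"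
  shows "z2_caratheodory TYPE('n) (sphere_metric :: 'a metric) uminus \<le> t"
proof -
  have "bdd_below {t. 0 \<le> t \<and> P t}" for P :: "real \<Rightarrow> bool"
    by (rule bdd_belowI[of _ 0]) simp
  then show ?thesis
    unfolding z2_caratheodory_def mspace_sphere_metric mtopology_of_sphere_metric
      continuous_map_iff_continuous
    using assms by (intro cInf_lower) blast+
qed

section \<open>Sign choices and packings of lines\<close>

lemma linear_relation_of_large_family:
  fixes v :: "'i \<Rightarrow> 'a::euclidean_space"
  assumes "finite I" "DIM('a) < card I"
  obtains c where "\<exists>i\<in>I. c i \<noteq> 0" "(\<Sum>i\<in>I. c i *\<^sub>R v i) = 0"
proof (cases "inj_on v I")
  case True
  have "dependent (v ` I)"
    using assms True by (intro dependent_biggerset) (simp add: card_image)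
  then obtain u where "\<exists>x\<in>v ` I. u x \<noteq> 0" "(\<Sum>x\<in>v ` I. u x *\<^sub>R x) = 0"
    using assms(1) by (auto simp: dependent_finite)
  with True show thesis
    by (intro that[of "u \<circ> v"]) (auto simp: sum.reindex)
next
  case False
  then obtain i j where ij: "i \<in> I" "j \<in> I" "i \<noteq> j" "v i = v j"
    by (auto simp: inj_on_def)
  let ?c = "\<lambda>k. (if k = i then 1 else 0) - (if k = j then 1 else 0 :: real)"
  have "(\<Sum>k\<in>I. ?c k *\<^sub>R v k) = (\<Sum>k\<in>I. if k = i then v k else 0) - (\<Sum>k\<in>I. if k = j then v k else 0)"
    unfolding sum_subtractf[symmetric] by (intro sum.cong) auto
  also have "\<dots> = 0"
    using ij assms(1) by simp
  finally show thesis
    using ij by (intro that[of ?c]) auto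
qed

text \<open>In a relation \<open>\<Sum>i\<in>I. c i *\<^sub>R f (x i) = 0\<close> oddness allows \<open>c i\<close> to be replaced by \<open>\<bar>c i\<bar>\<close> if \<open>x i\<close> is
  multiplied by the sign of \<open>c i\<close>. Division by \<open>\<Sum>i\<in>I. \<bar>c i\<bar>\<close> makes the combination convex.\<close>

lemma zero_in_hull_sign_choice:
  fixes f :: "'a::real_vector \<Rightarrow> 'b::euclidean_space"
  assumes "finite I" "DIM('b) < card I" and odd: "\<And>i. i \<in> I \<Longrightarrow> f (- x i) = - f (x i)"
  obtains s where "\<And>i. s i \<in> {1, -1 :: real}" "0 \<in> convex hull (f ` (\<lambda>i. s i *\<^sub>R x i) ` I)"
proof -
  obtain c where c: "\<exists>i\<in>I. c i \<noteq> 0" "(\<Sum>i\<in>I. c i *\<^sub>R f (x i)) = 0"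
    using linear_relation_of_large_family[OF assms(1,2)] by metis
  define T where "T = (\<Sum>i\<in>I. \<bar>c i\<bar>)"
  define s where "s i = (if c i \<ge> 0 then 1 else -1 :: real)" for i
  have "T > 0"
    unfolding T_def using c(1) assms(1) by (auto intro: sum_pos2)
  have "(\<Sum>i\<in>I. (\<bar>c i\<bar> / T) *\<^sub>R f (s i *\<^sub>R x i)) = (\<Sum>i\<in>I. (1 / T) *\<^sub>R c i *\<^sub>R f (x i))"
    using odd by (intro sum.cong) (auto simp: s_def)
  also have "\<dots> = 0"
    using c(2) by (simp only: scaleR_sum_right[symmetric] scaleR_zero_right)
  finally have "0 = (\<Sum>i\<in>I. (\<bar>c i\<bar> / T) *\<^sub>R f (s i *\<^sub>R x i))" ..
  also have "\<dots> \<in> convex hull (f ` (\<lambda>i. s i *\<^sub>R x i) ` I)"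
    using \<open>T > 0\<close> assms(1)
    by (intro convex_sum) (auto simp: T_def sum_divide_distrib[symmetric] intro!: hull_inc)
  finally show thesis
    by (rule that[rotated]) (auto simp: s_def)
qed

text \<open>Let \<open>u i\<close> be a unit vector on the line \<open>L i\<close>. For \<open>i \<noteq> j\<close> and any signs the points
  \<open>s i *\<^sub>R u i\<close> and \<open>s j *\<^sub>R u j\<close> have inner product at least \<open>- \<bar>u i \<bullet> u j\<bar>\<close>, so their angle
  is at most the supplement of the angle between the two lines.\<close>

lemma z2_caratheodory_le_of_separated_lines:
  fixes L :: "nat \<Rightarrow> 'a::euclidean_space set"
  assumes "0 < \<epsilon>" and L: "L ` {1..m} \<subseteq> proj_space" and "CARD('n) < m"
    and sep: "\<forall>i\<in>{1..m}. \<forall>j\<in>{1..m}. i \<noteq> j \<longrightarrow> \<epsilon> \<le> line_angle (L i) (L j)"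
  shows "z2_caratheodory TYPE('n::finite) (sphere_metric :: 'a metric) uminus \<le> pi - \<epsilon>"
proof -
  have "\<exists>u. norm u = 1 \<and> L i = span {u}" if "i \<in> {1..m}" for i
    using L that proj_space_spanE[of "L i"] by blast
  then obtain u where u: "\<And>i. i \<in> {1..m} \<Longrightarrow> norm (u i) = 1 \<and> L i = span {u i}"
    by metis
  have sep': "\<epsilon> \<le> arccos \<bar>u i \<bullet> u j\<bar>" if "i \<in> {1..m}" "j \<in> {1..m}" "i \<noteq> j" for i j
    using sep u that line_angle_span[of "u i" "u j"] by metis
  \<comment> \<open>There are at least two lines, and their angle bounds \<open>\<epsilon>\<close>, so \<open>\<pi> - \<epsilon>\<close> is not negative.\<close>
  have "CARD('n) \<ge> 1"
    by (simp add: Suc_leI)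
  then have "2 \<le> m"
    using \<open>CARD('n) < m\<close> by linarith
  then have "1 \<in> {1..m}" "2 \<in> {1..m}"
    by auto
  then have "\<epsilon> \<le> arccos \<bar>u 1 \<bullet> u 2\<bar>"
    by (intro sep') auto
  also have "\<dots> \<le> pi"
    using u unit_inner_bounds(3)[of "u 1" "u 2"] \<open>1 \<in> {1..m}\<close> \<open>2 \<in> {1..m}\<close>
    by (intro arccos_ubound) auto
  finally have "0 \<le> pi - \<epsilon>" by simp
  then show ?thesis
  proof (rule z2_caratheodory_sphere_le)
    fix f :: "'a \<Rightarrow> real^'n" assume odd: "\<And>x. x \<in> sphere 0 1 \<Longrightarrow> f (- x) = - f x"
    obtain s where s: "\<And>i. s i \<in> {1, -1 :: real}"
      and 0: "0 \<in> convex hull (f ` (\<lambda>i. s i *\<^sub>R u i) ` {1..m})"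
      using zero_in_hull_sign_choice[of "{1..m}" f u] \<open>CARD('n) < m\<close> odd u by auto
    let ?A = "(\<lambda>i. s i *\<^sub>R u i) ` {1..m}"
    have n: "norm (s i *\<^sub>R u i) = 1" if "i \<in> {1..m}" for i
      using u[OF that] s[of i] by auto
    have "mdiameter sphere_metric ?A \<le> pi - \<epsilon>"
    proof (rule mdiameter_sphere_leI)
      fix x y assume "x \<in> ?A" "y \<in> ?A"
      then obtain i j where ij: "i \<in> {1..m}" "j \<in> {1..m}"
        and xy: "x = s i *\<^sub>R u i" "y = s j *\<^sub>R u j"
        by blast
      show "arccos (x \<bullet> y) \<le> pi - \<epsilon>"
      proof (cases "i = j")
        case True
        then have "norm x = 1" "y = x"
          using n[OF ij(1)] xy by simp_all
        then have "x \<bullet> y = 1"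
          by (simp add: norm_eq_1)
        then show ?thesis
          using \<open>0 \<le> pi - \<epsilon>\<close> by simp
      next
        case False
        have b: "\<bar>u i \<bullet> u j\<bar> \<le> 1"
          using u ij by (intro unit_inner_bounds) auto
        have "\<bar>x \<bullet> y\<bar> = \<bar>u i \<bullet> u j\<bar>"
          using s[of i] s[of j] xy by auto
        then have "- \<bar>u i \<bullet> u j\<bar> \<le> x \<bullet> y" "x \<bullet> y \<le> 1"
          using b by linarith+
        then have "arccos (x \<bullet> y) \<le> arccos (- \<bar>u i \<bullet> u j\<bar>)"
          using b by (intro arccos_le_arccos) auto
        also have "\<dots> = pi - arccos \<bar>u i \<bullet> u j\<bar>"
          using b by (intro arccos_minus) auto
        finally show ?thesis
          using sep'[OF ij False] by linarith
      qed
    qed (use n \<open>0 \<le> pi - \<epsilon>\<close> in auto)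
    then show "\<exists>A\<subseteq>sphere 0 1. mdiameter sphere_metric A \<le> pi - \<epsilon> \<and> 0 \<in> convex hull (f ` A)"
      using 0 n by (intro exI[of _ ?A]) auto
  qed
qed

text \<open>The slope \<open>i\<close> tells the lines apart; the \<open>b\<close>-component of a point fixes its scale.\<close>

lemma lines_of_distinct_slope:
  fixes b c :: "'a::euclidean_space"
  assumes "b \<in> Basis" "c \<in> Basis" "b \<noteq> c"
  shows "inj (\<lambda>i::nat. span {b + real i *\<^sub>R c})" "span {b + real i *\<^sub>R c} \<in> proj_space"
proof -
  have ip: "(b + t *\<^sub>R c) \<bullet> b = 1" "(b + t *\<^sub>R c) \<bullet> c = t" for t
    using assms by (auto simp: inner_simps inner_Basis)
  show "inj (\<lambda>i::nat. span {b + real i *\<^sub>R c})"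
  proof (rule injI)
    fix i j :: nat assume "span {b + real i *\<^sub>R c} = span {b + real j *\<^sub>R c}"
    then have "b + real i *\<^sub>R c \<in> span {b + real j *\<^sub>R c}"
      by (metis singletonI span_base)
    then obtain k where k: "b + real i *\<^sub>R c = k *\<^sub>R (b + real j *\<^sub>R c)"
      by (auto simp: span_singleton)
    then have "k = 1"
      using ip(1)[of "real i"] ip(1)[of "real j"] by simp
    then show "i = j"
      using k nonzero_Basis[OF assms(2)] by simp
  qed
  have "b + real i *\<^sub>R c \<noteq> 0"
    using ip(1)[of "real i"] by auto
  then show "span {b + real i *\<^sub>R c} \<in> proj_space"
    by (auto simp: proj_space_def)
qed

text \<open>The packing number is a supremum of a nonempty set because \<open>proj_space\<close> is infinite from
  dimension 2 on. In dimension 1 there is only one line.\<close>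

lemma exists_separated_lines:
  fixes m :: nat
  assumes "2 \<le> DIM('a::euclidean_space)"
  shows "\<exists>\<epsilon>>0. \<exists>L. L ` {1..m} \<subseteq> (proj_space :: 'a set set) \<and>
     (\<forall>i\<in>{1..m}. \<forall>j\<in>{1..m}. i \<noteq> j \<longrightarrow> \<epsilon> \<le> line_angle (L i) (L j))"
proof -
  obtain b c :: 'a where bc: "b \<in> Basis" "c \<in> Basis" "b \<noteq> c"
    using assms by (metis card_2_iff' obtain_subset_with_card_n subset_iff)
  define L where "L = (\<lambda>i::nat. span {b + real i *\<^sub>R c})"
  have L: "inj L" "L i \<in> proj_space" for i
    using lines_of_distinct_slope[OF bc] by (auto simp: L_def)
  define P where "P = {(i, j). i \<in> {1..m::nat} \<and> j \<in> {1..m} \<and> i \<noteq> j}"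
  \<comment> \<open>The 1 keeps the set nonempty when \<open>m \<le> 1\<close>.\<close>
  define \<epsilon> where "\<epsilon> = Min (insert 1 ((\<lambda>(i, j). line_angle (L i) (L j)) ` P))"
  have "finite P"
    by (rule finite_subset[of _ "{1..m} \<times> {1..m}"]) (auto simp: P_def)
  have "0 < line_angle (L i) (L j)" if "i \<noteq> j" for i j
    using that L by (simp add: inj_eq less_le)
  then have "0 < \<epsilon>"
    unfolding \<epsilon>_def using \<open>finite P\<close> by (subst Min_gr_iff) (auto simp: P_def)
  moreover have "\<epsilon> \<le> line_angle (L i) (L j)" if "(i, j) \<in> P" for i j
    unfolding \<epsilon>_def using \<open>finite P\<close> that by (intro Min_le) auto
  ultimately show ?thesis
    using L(2) by (intro exI[of _ \<epsilon>] conjI exI[of _ L]) (auto simp: P_def)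
qed

theorem z2_caratheodory_le_pi_minus_packing_number:
  assumes "2 \<le> DIM('a::euclidean_space)" "CARD('n) < m"
  shows "z2_caratheodory TYPE('n::finite) (sphere_metric :: 'a metric) uminus
    \<le> pi - packing_number m (proj_metric :: 'a set metric)"
proof -
  have "packing_number m (proj_metric :: 'a set metric)
      \<le> pi - z2_caratheodory TYPE('n) (sphere_metric :: 'a metric) uminus"
    unfolding packing_number_def mspace_proj_metric mdist_proj_metric
  proof (rule cSup_least)
    show "{\<epsilon>. 0 < \<epsilon> \<and> (\<exists>y. y ` {1..m} \<subseteq> (proj_space :: 'a set set) \<and>
        (\<forall>i\<in>{1..m}. \<forall>j\<in>{1..m}. i \<noteq> j \<longrightarrow> \<epsilon> \<le> line_angle (y i) (y j)))} \<noteq> {}"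
      using exists_separated_lines[OF assms(1), of m] by blast
  next
    fix \<epsilon> assume "\<epsilon> \<in> {\<epsilon>. 0 < \<epsilon> \<and> (\<exists>y. y ` {1..m} \<subseteq> (proj_space :: 'a set set) \<and>
        (\<forall>i\<in>{1..m}. \<forall>j\<in>{1..m}. i \<noteq> j \<longrightarrow> \<epsilon> \<le> line_angle (y i) (y j)))}"
    then obtain L :: "nat \<Rightarrow> 'a set" where "0 < \<epsilon>" "L ` {1..m} \<subseteq> proj_space"
      "\<forall>i\<in>{1..m}. \<forall>j\<in>{1..m}. i \<noteq> j \<longrightarrow> \<epsilon> \<le> line_angle (L i) (L j)"
      by blast
    from z2_caratheodory_le_of_separated_lines[OF this(1,2) assms(2) this(3)]
    show "\<epsilon> \<le> pi - z2_caratheodory TYPE('n) (sphere_metric :: 'a metric) uminus"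
      by simp
  qed
  then show ?thesis by simp
qed

section \<open>Convex hulls and expectations\<close>

text \<open>Several points of \<open>A\<close> may have the same image, so one preimage of each point of the convex
  combination is selected to carry its whole weight.\<close>

lemma convex_hull_image_imp_pmf:
  fixes f :: "'a \<Rightarrow> 'b::{banach, second_countable_topology}"
  assumes "y \<in> convex hull (f ` A)"
  obtains \<mu> where "finite (set_pmf \<mu>)" "set_pmf \<mu> \<subseteq> A" "measure_pmf.expectation \<mu> f = y"
proof -
  obtain S u where S: "finite S" "S \<subseteq> f ` A"
    and u: "\<forall>s\<in>S. 0 \<le> u s" "sum u S = 1" "(\<Sum>s\<in>S. u s *\<^sub>R s) = y"
    using assms unfolding convex_hull_explicit by blast
  obtain B where B: "B \<subseteq> A" "inj_on f B" "f ` B = S"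
    using S(2) subset_image_inj[of S f A] by blast
  have "finite B"
    using B S(1) finite_image_iff by blast
  define p where "p a = (if a \<in> B then u (f a) else 0)" for a
  have p0: "0 \<le> p a" for a
    using u(1) B by (auto simp: p_def)
  have p_outside: "a \<notin> B \<Longrightarrow> p a = 0" for a
    by (simp add: p_def)
  have "(\<Sum>a\<in>B. p a) = 1"
    using u(2) B by (auto simp: p_def sum.reindex)
  then have "(\<integral>\<^sup>+ a. ennreal (p a) \<partial>count_space UNIV) = 1"
    using \<open>finite B\<close> p0 sum_ennreal[of B p]
    by (subst nn_integral_count_space'[of B]) (auto simp: p_outside)
  note pmf = pmf_embed_pmf[of p, OF p0 this] set_embed_pmf[of p, OF p0 this]
  then have set: "set_pmf (embed_pmf p) \<subseteq> B"
    by (auto simp: p_def split: if_splits)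
  then have "measure_pmf.expectation (embed_pmf p) f = (\<Sum>a\<in>B. u (f a) *\<^sub>R f a)"
    using \<open>finite B\<close> by (subst integral_measure_pmf[of B]) (auto simp: pmf p_def)
  also have "\<dots> = y"
    using B u(3) by (auto simp: sum.reindex)
  finally show thesis
    using set B(1) \<open>finite B\<close> by (intro that[of "embed_pmf p"]) (auto intro: finite_subset)
qed

lemma expectation_in_convex_hull:
  fixes f :: "'a \<Rightarrow> 'b::{banach, second_countable_topology}"
  assumes "finite (set_pmf \<mu>)" "set_pmf \<mu> \<subseteq> A"
  shows "measure_pmf.expectation \<mu> f \<in> convex hull (f ` A)"
proof -
  have "(\<Sum>a\<in>set_pmf \<mu>. pmf \<mu> a *\<^sub>R f a) \<in> convex hull (f ` A)"
    using assms by (intro convex_sum) (auto simp: sum_pmf_eq_1 intro!: hull_inc)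
  then show ?thesis
    using assms(1) by (subst integral_measure_pmf[of "set_pmf \<mu>"]) auto
qed

theorem corollary4p4:
  fixes d n :: nat and \<delta> :: real
  assumes "d \<ge> 1" and "n \<ge> 1"
    and "CARD('k::finite) = d + 1" and "CARD('n::finite) = n"
  shows "(\<delta> \<ge> pi - packing_number (n + 1) (proj_metric :: (real^'k) set metric) \<longrightarrow>
            \<delta> \<ge> z2_caratheodory TYPE('n) (sphere_metric :: (real^'k) metric) uminus)
       \<and> (\<delta> \<ge> z2_caratheodory TYPE('n) (sphere_metric :: (real^'k) metric) uminus \<longrightarrow>
            (\<forall>f :: real^'k \<Rightarrow> real^'n. continuous_on (sphere 0 1) f \<longrightarrow>
              (\<exists>X \<subseteq> sphere 0 1. mdiameter sphere_metric X \<le> \<delta> \<and>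
                 convex hull (f ` X) \<inter> convex hull (f ` uminus ` X) \<noteq> {} \<and>
                 (\<exists>\<mu> \<in> thickening sphere_metric \<delta>. set_pmf \<mu> \<subseteq> X \<and>
                    measure_pmf.expectation \<mu> f = measure_pmf.expectation \<mu> (\<lambda>x. f (- x))))))"
proof (intro conjI impI allI)
  let ?c = "z2_caratheodory TYPE('n) (sphere_metric :: (real^'k) metric) uminus"
  have "?c \<le> pi - packing_number (n + 1) (proj_metric :: (real^'k) set metric)"
    using assms by (intro z2_caratheodory_le_pi_minus_packing_number) auto
  then show "?c \<le> \<delta>" if "pi - packing_number (n + 1) (proj_metric :: (real^'k) set metric) \<le> \<delta>"
    using that by linarith
  fix f :: "real^'k \<Rightarrow> real^'n"
  assume \<delta>: "?c \<le> \<delta>" and cont: "continuous_on (sphere 0 1) f"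
  have cont': "continuous_on (sphere 0 1) (\<lambda>x. f x - f (- x))"
    by (intro continuous_intros cont continuous_on_compose2[OF cont]) auto
  obtain X where X: "X \<subseteq> sphere 0 1" "mdiameter sphere_metric X \<le> ?c"
    and hull: "0 \<in> convex hull ((\<lambda>x. f x - f (- x)) ` X)"
    by (rule z2_caratheodory_sphere_attained[OF cont']) auto
  obtain \<mu> where \<mu>: "finite (set_pmf \<mu>)" "set_pmf \<mu> \<subseteq> X"
    and 0: "measure_pmf.expectation \<mu> (\<lambda>x. f x - f (- x)) = 0"
    by (rule convex_hull_image_imp_pmf[OF hull])
  have E: "measure_pmf.expectation \<mu> f = measure_pmf.expectation \<mu> (\<lambda>x. f (- x))"
    using 0 \<mu>(1) by (simp add: Bochner_Integration.integral_diff integrable_measure_pmf_finite)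
  have "measure_pmf.expectation \<mu> f \<in> convex hull (f ` X)"
    using \<mu> by (rule expectation_in_convex_hull)
  moreover have "measure_pmf.expectation \<mu> f \<in> convex hull (f ` uminus ` X)"
    unfolding E image_image using \<mu> by (rule expectation_in_convex_hull)
  moreover have "\<mu> \<in> thickening sphere_metric \<delta>"
    using \<mu> X \<delta> mdiameter_sphere_mono[OF X(1) \<mu>(2)] by (auto simp: thickening_def)
  ultimately show "\<exists>X\<subseteq>sphere 0 1. mdiameter sphere_metric X \<le> \<delta> \<and>
      convex hull (f ` X) \<inter> convex hull (f ` uminus ` X) \<noteq> {} \<and>
      (\<exists>\<mu>\<in>thickening sphere_metric \<delta>. set_pmf \<mu> \<subseteq> X \<and>
         measure_pmf.expectation \<mu> f = measure_pmf.expectation \<mu> (\<lambda>x. f (- x)))"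
    using X \<delta> \<mu>(2) E by (intro exI[of _ X]) auto
qed

end
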